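(* Let $G$ be a finite non-abelian group. If the commuting graph $\mathcal{G}(G)$ contains at least one cycle, then the girth of $\mathcal{G}(G)$ is equal to $3$.
   Context: For a finite non-abelian group $G$ with center $Z(G)$, the commuting graph $\mathcal{G}(G)$ is the simple graph with vertex set $G\setminus Z(G)$ in which two distinct vertices $x,y$ are adjacent if and only if $xy=yx$. The girth of a graph containing cycles is the length of a shortest cycle. *)

theory Defs
  imports
    "HOL-Algebra.Group"
    "HOL-Library.Extended_Nat"
    "Graph_Theory.Pair_Digraph"
begin

definition group_center :: "('a, 'm) monoid_scheme \<Rightarrow> 'a set" where
  "group_center G = {z \<in> carrier G. \<forall>g\<in>carrier G. z \<otimes>\<^bsub>G\<^esub> g = g \<otimes>\<^bsub>G\<^esub> z}"

text \<open>An undirected simple graph is represented, as in \<^locale>\<open>pair_graph\<close>, by its vertex set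
  and a symmetric irreflexive set of arcs, each edge contributing both of its orientations.\<close>

definition commuting_graph :: "('a, 'm) monoid_scheme \<Rightarrow> 'a pair_pre_digraph" where
  "commuting_graph G =
    \<lparr>pverts = carrier G - group_center G,
     parcs = {(x, y). x \<in> carrier G - group_center G \<and> y \<in> carrier G - group_center G
                \<and> x \<noteq> y \<and> x \<otimes>\<^bsub>G\<^esub> y = y \<otimes>\<^bsub>G\<^esub> x}\<rparr>"

lemma pair_graph_commuting_graph:
  assumes "finite (carrier G)"
  shows "pair_graph (commuting_graph G)"
proof
  show "finite (parcs (commuting_graph G))"
    by (rule finite_subset[of _ "carrier G \<times> carrier G"])
      (use assms in \<open>auto simp: commuting_graph_def\<close>)
qed (use assms in \<open>auto simp: commuting_graph_def symmetric_def sym_def\<close>)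

text \<open>\<^const>\<open>pre_digraph.cycle\<close> admits the directed cycle \<open>u, v, u\<close> that traverses one edge of a
  symmetric digraph back and forth; the length bound excludes it, leaving exactly the
  (rooted, oriented) cycles of the undirected graph.\<close>

definition graph_cycle :: "'a pair_pre_digraph \<Rightarrow> ('a \<times> 'a) awalk \<Rightarrow> bool" where
  "graph_cycle H p \<longleftrightarrow> pre_digraph.cycle (with_proj H) p \<and> 3 \<le> length p"

text \<open>The girth of an acyclic graph is \<open>\<infinity>\<close>, the infimum of the empty set.\<close>

definition girth :: "'a pair_pre_digraph \<Rightarrow> enat" where
  "girth H = (INF p\<in>{p. graph_cycle H p}. enat (length p))"

end

theory Submission
  imports Defs
begin

text \<open>
  A cycle contains a path \<open>x\<close>, \<open>y\<close>, \<open>z\<close> with \<open>x \<noteq> z\<close>, and such a path already forces a triangle.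
  If \<open>x\<close> and \<open>z\<close> commute, the three vertices form one. If they do not, then \<open>x \<otimes> y\<close>
  does not commute with \<open>z\<close>: as \<open>y\<close> commutes with \<open>z\<close>, cancelling \<open>y\<close> would make \<open>x\<close> and \<open>z\<close> commute.
  So \<open>x \<otimes> y\<close> is not central. It commutes with both \<open>x\<close> and \<open>y\<close>, and differs
  from both because neither is the identity; hence \<open>x\<close>, \<open>y\<close>, \<open>x \<otimes> y\<close> is a triangle. This is
  \<open>commuting_path_imp_triangle\<close>; the girth is at least 3 for any graph that has a cycle.
\<close>

lemma cycle_imp_path:
  assumes "graph_cycle H p"
  obtains x y z where "(x, y) \<in> parcs H" "(y, z) \<in> parcs H" "x \<noteq> z"
proof -
  from assms have len: "3 \<le> length p" and cyc: "pre_digraph.cycle (with_proj H) p"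
    by (auto simp: graph_cycle_def)
  from len obtain e1 e2 e3 q where p: "p = e1 # e2 # e3 # q"
    by (auto simp: numeral_3_eq_3 Suc_le_length_iff)
  from cyc obtain u where
      arcs: "set p \<subseteq> parcs H" and cas: "pre_digraph.cas (with_proj H) u p u"
      and dist: "distinct (tl (pre_digraph.awalk_verts (with_proj H) u p))"
    by (auto simp: pre_digraph.cycle_def pre_digraph.awalk_def)
  \<comment> \<open>Distinctness is only granted for the vertex list without its head, which for a closed walk
    repeats at the end; so the path starts at the second arc rather than the first.\<close>
  show thesis
  proof (rule that)
    show "(fst e2, fst e3) \<in> parcs H" "(fst e3, snd e3) \<in> parcs H" "fst e2 \<noteq> snd e3"
      using arcs cas dist unfolding p
      by (cases q; auto simp: pre_digraph.cas.simps pre_digraph.awalk_verts.simps; metis prod.collapse)+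
  qed
qed

lemma triangle_imp_cycle:
  assumes "pair_wf_digraph H"
    and "(x, y) \<in> parcs H" "(y, z) \<in> parcs H" "(z, x) \<in> parcs H"
    and "x \<noteq> y" "y \<noteq> z" "z \<noteq> x"
  shows "graph_cycle H [(x, y), (y, z), (z, x)]"
proof -
  interpret pair_wf_digraph H by fact
  have "x \<in> pverts H"
    using assms(2) arc_fst_in_verts by fastforce
  with assms show ?thesis
    by (auto simp: graph_cycle_def cycle_def awalk_def)
qed

lemma commuting_path_imp_triangle:
  assumes "group G"
    and xy: "(x, y) \<in> parcs (commuting_graph G)"
    and yz: "(y, z) \<in> parcs (commuting_graph G)"
    and "x \<noteq> z"
  obtains w where "(x, w) \<in> parcs (commuting_graph G)" "(y, w) \<in> parcs (commuting_graph G)"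
proof (cases "x \<otimes>\<^bsub>G\<^esub> z = z \<otimes>\<^bsub>G\<^esub> x")
  case True
  with assms show thesis
    by (intro that[of z]) (auto simp: commuting_graph_def)
next
  case False
  interpret group G by fact
  have car: "x \<in> carrier G" "y \<in> carrier G" "z \<in> carrier G"
    and nc: "x \<notin> group_center G" "y \<notin> group_center G"
    and cxy: "x \<otimes>\<^bsub>G\<^esub> y = y \<otimes>\<^bsub>G\<^esub> x" and cyz: "y \<otimes>\<^bsub>G\<^esub> z = z \<otimes>\<^bsub>G\<^esub> y"
    using xy yz by (auto simp: commuting_graph_def)
  let ?w = "x \<otimes>\<^bsub>G\<^esub> y"
  have "?w \<notin> group_center G"
  proof
    assume "?w \<in> group_center G"
    with car have "?w \<otimes>\<^bsub>G\<^esub> z = z \<otimes>\<^bsub>G\<^esub> ?w"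
      by (auto simp: group_center_def)
    with car cyz have "(x \<otimes>\<^bsub>G\<^esub> z) \<otimes>\<^bsub>G\<^esub> y = (z \<otimes>\<^bsub>G\<^esub> x) \<otimes>\<^bsub>G\<^esub> y"
      by (simp add: m_assoc)
    with car False show False
      by simp
  qed
  moreover have "\<one>\<^bsub>G\<^esub> \<in> group_center G"
    by (simp add: group_center_def)
  then have "?w \<noteq> x" "?w \<noteq> y"
    using car nc by auto
  moreover have "x \<otimes>\<^bsub>G\<^esub> ?w = ?w \<otimes>\<^bsub>G\<^esub> x"
    using car by (metis cxy m_assoc)
  moreover have "y \<otimes>\<^bsub>G\<^esub> ?w = ?w \<otimes>\<^bsub>G\<^esub> y"
    using car by (metis cxy m_assoc)
  ultimately show thesis
    using car nc by (intro that[of ?w]) (auto simp: commuting_graph_def)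
qed

theorem proposition4p2:
  fixes G :: "('a, 'm) monoid_scheme"
  assumes "group G"
    and "finite (carrier G)"
    and "\<not> comm_group G"
    and "\<exists>p. graph_cycle (commuting_graph G) p"
  shows "girth (commuting_graph G) = 3"
proof -
  let ?H = "commuting_graph G"
  interpret pair_graph ?H
    using assms(2) by (rule pair_graph_commuting_graph)
  from assms(4) obtain x y z where
    path: "(x, y) \<in> parcs ?H" "(y, z) \<in> parcs ?H" "x \<noteq> z"
    by (blast elim: cycle_imp_path)
  from assms(1) path obtain w where
    w: "(x, w) \<in> parcs ?H" "(y, w) \<in> parcs ?H"
    by (rule commuting_path_imp_triangle)
  have "graph_cycle ?H [(x, y), (y, w), (w, x)]"
    using path w by (intro triangle_imp_cycle pair_wf_digraph_axioms)
      (auto simp: commuting_graph_def)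
  then have "girth ?H \<le> enat (length [(x, y), (y, w), (w, x)])"
    unfolding girth_def by (intro INF_lower) simp
  then have "girth ?H \<le> 3"
    by (simp add: numeral_eq_enat numeral_3_eq_3)
  moreover have "3 \<le> girth ?H"
    unfolding girth_def by (intro INF_greatest) (auto simp: graph_cycle_def numeral_eq_enat)
  ultimately show ?thesis
    by (rule antisym)
qed

end
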